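(* Let $\mathcal I,\mathcal J$ be ideals on $\omega$ and let $\mathcal F\subseteq\omega^\omega$. If $\mathfrak{fip}(\mathcal I,\mathcal J,\mathcal F)\ge|\mathcal F|$, then there exists an ultrafilter $\mathcal U$ on $\omega$ such that $\mathcal I\not\le_{\mathcal F}\mathcal U^*$ and $\mathcal J\subseteq\mathcal U^*$. In particular, if (under this assumption) $\mathcal F=\omega^\omega$ ($\mathcal F$ is the family of all finite-to-one functions, or $\mathcal F$ is the family of all one-to-one functions $\omega\to\omega$, respectively), then there exists an $\mathcal I$-ultrafilter (a weak $\mathcal I$-ultrafilter, or an $\mathcal I$-point, respectively) which is not a $\mathcal J$-point.
   Context: An ideal on $\omega$ is a family of subsets of $\omega$ closed under finite unions and subsets, containing all finite sets and not containing $\omega$; $\mathcal J^+=\mathcal P(\omega)\setminus\mathcal J$. Ultrafilters on $\omega$ contain all cofinite sets; $\mathcal U^*=\{\omega\setminus A:A\in\mathcal U\}$ is the dual ideal. For $\mathcal F\subseteq\omega^\omega$ and ideals $\mathcal I,\mathcal K$ on $\omega$, $\mathcal I\le_{\mathcal F}\mathcal K$ means that there is $f\in\mathcal F$ with $f^{-1}[B]\in\mathcal K$ for every $B\in\mathcal I$. A nonempty family $\mathcal A\subseteq\mathcal P(\omega)$ has $\mathcal J^+$-FIP if $\bigcap F\in\mathcal J^+$ for each finite $F\subseteq\mathcal A$. With $\mathfrak c=2^{\aleph_0}$ and $\mathfrak c^+$ its successor cardinal, $\mathfrak{fip}(\mathcal I,\mathcal J,\mathcal F)$ is the minimum of the set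 consisting of $\mathfrak c^+$ and all cardinals $|\mathcal A|$ such that $\mathcal A$ has $\mathcal J^+$-FIP (so $\mathcal A$ is a nonempty family of subsets of $\omega$) and it is not true that for every $f\in\mathcal F$ there is $B\in\mathcal I$ such that $\mathcal A\cup\{f^{-1}[B]\}$ has $\mathcal J^+$-FIP. An ultrafilter $\mathcal U$ on $\omega$ is an $\mathcal I$-ultrafilter (weak $\mathcal I$-ultrafilter, $\mathcal I$-point, respectively) if $\mathcal I\not\le_{\mathcal F}\mathcal U^*$ where $\mathcal F$ is the family of all (all finite-to-one, all one-to-one, respectively) functions $\omega\to\omega$; a $\mathcal J$-point is defined in the same way with $\mathcal J$ in place of $\mathcal I$. A function is finite-to-one if preimages of points are finite.
   Formalization: When F has exactly one element, the inequality fip(I,J,F) ≥ |F| is required to be strict; for I = J and F = {id} one has fip = 1 = |F|, but no such ultrafilter exists, so the statement fails as written. *)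

theory Defs
  imports Main
begin

unbundle cardinal_syntax

definition ideal_on_omega :: "nat set set \<Rightarrow> bool" where
  "ideal_on_omega J \<longleftrightarrow>
     (\<forall>A\<in>J. \<forall>B. B \<subseteq> A \<longrightarrow> B \<in> J) \<and> (\<forall>A\<in>J. \<forall>B\<in>J. A \<union> B \<in> J) \<and>
     (\<forall>A. finite A \<longrightarrow> A \<in> J) \<and> UNIV \<notin> J"

definition ultrafilter_on_omega :: "nat set set \<Rightarrow> bool" where
  "ultrafilter_on_omega U \<longleftrightarrow>
     {} \<notin> U \<and> (\<forall>A\<in>U. \<forall>B. A \<subseteq> B \<longrightarrow> B \<in> U) \<and> (\<forall>A\<in>U. \<forall>B\<in>U. A \<inter> B \<in> U) \<and>
     (\<forall>A. A \<in> U \<or> - A \<in> U) \<and> (\<forall>A. finite (- A) \<longrightarrow> A \<in> U)"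

definition dual_ideal :: "nat set set \<Rightarrow> nat set set" where
  "dual_ideal U = {- A | A. A \<in> U}"

definition below_via :: "(nat \<Rightarrow> nat) set \<Rightarrow> nat set set \<Rightarrow> nat set set \<Rightarrow> bool" where
  "below_via F I K \<longleftrightarrow> (\<exists>f\<in>F. \<forall>B\<in>I. f -` B \<in> K)"

definition positive :: "nat set set \<Rightarrow> nat set set" where
  "positive J = - J"

definition positive_FIP :: "nat set set \<Rightarrow> nat set set \<Rightarrow> bool" where
  "positive_FIP J \<A> \<longleftrightarrow> \<A> \<noteq> {} \<and> (\<forall>S. S \<subseteq> \<A> \<and> finite S \<longrightarrow> \<Inter>S \<in> positive J)"

definition fip_family ::
    "nat set set \<Rightarrow> nat set set \<Rightarrow> (nat \<Rightarrow> nat) set \<Rightarrow> nat set set \<Rightarrow> bool" where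
  "fip_family I J F \<A> \<longleftrightarrow>
     positive_FIP J \<A> \<and> \<not> (\<forall>f\<in>F. \<exists>B\<in>I. positive_FIP J (\<A> \<union> {f -` B}))"

text \<open>
  Cardinals are represented by the cardinal orders on the type \<^typ>\<open>nat set set\<close>, up to
  equality of cardinals.  This type carries \<open>\<cc>\<^sup>+\<close>, the cardinal successor of the cardinality of
  the type \<^typ>\<open>nat set\<close>, hence all cardinals that can occur below.
\<close>

definition fip_cardinals ::
    "nat set set \<Rightarrow> nat set set \<Rightarrow> (nat \<Rightarrow> nat) set \<Rightarrow> nat set set rel set" where
  "fip_cardinals I J F =
     {r. Card_order r \<and>
         (r =o cardSuc |UNIV :: nat set set| \<or> (\<exists>\<A>. fip_family I J F \<A> \<and> r =o |\<A>| ))}"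

definition fip :: "nat set set \<Rightarrow> nat set set \<Rightarrow> (nat \<Rightarrow> nat) set \<Rightarrow> nat set set rel" where
  "fip I J F = (SOME r. r \<in> fip_cardinals I J F \<and> (\<forall>s\<in>fip_cardinals I J F. r \<le>o s))"

lemma fip_is_minimum:
  "fip I J F \<in> fip_cardinals I J F \<and> (\<forall>s\<in>fip_cardinals I J F. fip I J F \<le>o s)"
proof -
  have "cardSuc |UNIV :: nat set set| \<in> fip_cardinals I J F"
    unfolding fip_cardinals_def mem_Collect_eq
    by (intro conjI disjI1 ordIso_refl cardSuc_Card_order card_of_Card_order)
  then have "\<exists>r\<in>fip_cardinals I J F. \<forall>s\<in>fip_cardinals I J F. r \<le>o s"
    by (intro exists_minim_Card_order) (auto simp: fip_cardinals_def)
  then have "\<exists>r. r \<in> fip_cardinals I J F \<and> (\<forall>s\<in>fip_cardinals I J F. r \<le>o s)"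
    by blast
  then show ?thesis
    unfolding fip_def by (rule someI_ex)
qed

lemma fip_le_family:
  assumes "fip_family I J F \<A>"
  shows "fip I J F \<le>o |\<A>|"
proof -
  let ?r = "|(\<lambda>A. {A}) ` \<A>|"
  have iso: "?r =o |\<A>|"
    by (rule ordIso_symmetric, rule card_of_ordIsoI[where f = "\<lambda>A. {A}"])
       (auto simp: bij_betw_def inj_on_def)
  then have "?r \<in> fip_cardinals I J F"
    unfolding fip_cardinals_def mem_Collect_eq
    by (intro conjI disjI2 exI[of _ \<A>] card_of_Card_order assms)
  then have "fip I J F \<le>o ?r"
    by (rule bspec[OF fip_is_minimum[THEN conjunct2]])
  from ordLeq_ordIso_trans[OF this iso] show ?thesis .
qed

definition finite_to_one :: "(nat \<Rightarrow> nat) \<Rightarrow> bool" where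
  "finite_to_one f \<longleftrightarrow> (\<forall>n. finite (f -` {n}))"

definition I_ultrafilter :: "nat set set \<Rightarrow> nat set set \<Rightarrow> bool" where
  "I_ultrafilter I U \<longleftrightarrow> ultrafilter_on_omega U \<and> \<not> below_via UNIV I (dual_ideal U)"

definition weak_I_ultrafilter :: "nat set set \<Rightarrow> nat set set \<Rightarrow> bool" where
  "weak_I_ultrafilter I U \<longleftrightarrow>
     ultrafilter_on_omega U \<and> \<not> below_via {f. finite_to_one f} I (dual_ideal U)"

definition I_point :: "nat set set \<Rightarrow> nat set set \<Rightarrow> bool" where
  "I_point I U \<longleftrightarrow> ultrafilter_on_omega U \<and> \<not> below_via {f. inj f} I (dual_ideal U)"

text \<open>
  The inequality \<open>|F| \<le> fip I J F\<close> holds for every one-element \<open>F\<close>, because families with FIP are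
  nonempty.  But for \<open>F = {id}\<close> and \<open>I = J\<close> no ultrafilter \<open>U\<close> satisfies both
  \<open>\<not> below_via F I (dual_ideal U)\<close> and \<open>J \<subseteq> dual_ideal U\<close>.  Existence theorems
  therefore have to require a strict inequality when \<open>F\<close> has exactly one element.
\<close>

lemma singleton_card_le_fip:
  fixes f :: "nat \<Rightarrow> nat"
  shows "|{f}| \<le>o fip I J {f}"
proof -
  have le: "|{f}| \<le>o |X|" if "X \<noteq> {}" for X :: "nat set set"
    by (rule card_of_singl_ordLeq[OF that])
  have mem: "fip I J {f} \<in> fip_cardinals I J {f}"
    by (rule fip_is_minimum[THEN conjunct1])
  consider "fip I J {f} =o cardSuc |UNIV :: nat set set|"
    | \<A> :: "nat set set" where "\<A> \<noteq> {}" "fip I J {f} =o |\<A>|"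
  proof -
    have "fip I J {f} =o cardSuc |UNIV :: nat set set| \<or>
        (\<exists>\<A>. fip_family I J {f} \<A> \<and> fip I J {f} =o |\<A>| )"
      using mem unfolding fip_cardinals_def mem_Collect_eq by (rule conjunct2)
    moreover have "\<A> \<noteq> {}" if "fip_family I J {f} \<A>" for \<A>
      using that by (simp add: fip_family_def positive_FIP_def)
    ultimately show thesis
      using that by metis
  qed
  then show ?thesis
  proof cases
    case 1
    have "|{f}| \<le>o |UNIV :: nat set set|"
      by (rule le) simp
    from ordLeq_transitive[OF this cardSuc_ordLeq[OF card_of_Card_order]]
    show ?thesis
      by (rule ordLeq_ordIso_trans[OF _ ordIso_symmetric[OF 1]])
  next
    case 2
    show ?thesis
      by (rule ordLeq_ordIso_trans[OF le[OF 2(1)] ordIso_symmetric[OF 2(2)]])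
  qed
qed

lemma singleton_no_ultrafilter:
  "\<not> (\<exists>U. ultrafilter_on_omega U \<and> \<not> below_via {id} J (dual_ideal U) \<and> J \<subseteq> dual_ideal U)"
  by (auto simp: below_via_def)

end

theory Submission
  imports Defs
begin

text \<open>
  An ultrafilter \<open>U\<close> with \<open>J \<subseteq> dual_ideal U\<close> escapes \<open>below_via F I\<close> as soon as it contains, for
  each \<open>f \<in> F\<close>, a preimage \<open>f -` B\<close> with \<open>B \<in> I\<close>.  So the aim is to choose \<open>h f \<in> I\<close> for every
  \<open>f \<in> F\<close> such that all sets \<open>f -` h f\<close> together have \<open>J\<close>-positive finite intersections; Zorn's
  lemma then extends them to an ultrafilter all of whose members are \<open>J\<close>-positive
  (\<open>positive_FIP_extends_to_ultrafilter\<close>).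

  The choice is made by recursion along a well-order of \<open>F\<close> of type \<open>|F|\<close>.  Only finitely many
  sets enter an intersection, so limit stages are harmless
  (\<open>positive_FIP_of_initial_segments\<close>).  At stage \<open>f\<close> fewer than \<open>|F|\<close> sets have been chosen.  If
  infinitely many have been, they form a family of size less than \<open>fip I J F\<close>, so by
  minimality of \<open>fip\<close> some \<open>f -` B\<close> can be added to it.  If only finitely many have
  been, counting them is too crude, since \<open>UNIV\<close> joins the family to keep it nonempty; instead
  they are replaced by their intersection, a family with one element, so that \<open>1 < fip I J F\<close> is
  enough (\<open>positive_FIP_extend\<close>).  That inequality follows from the hypotheses: it is
  assumed if \<open>F\<close> is a singleton, and otherwise \<open>1 < |F| \<le> fip I J F\<close> whenever there is a
  stage at all.

  Finally, \<open>J \<subseteq> dual_ideal U\<close> prevents \<open>U\<close> from being a \<open>J\<close>-point, as the identity witnesses.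
\<close>

lemma ideal_subset:
  assumes "ideal_on_omega J" "A \<in> J" "B \<subseteq> A"
  shows "B \<in> J"
  using assms unfolding ideal_on_omega_def by simp

lemma ideal_Un:
  assumes "ideal_on_omega J" "A \<in> J" "B \<in> J"
  shows "A \<union> B \<in> J"
  using assms unfolding ideal_on_omega_def by simp

lemma positive_FIP_InterD:
  assumes "positive_FIP J \<A>" "S \<subseteq> \<A>" "finite S"
  shows "\<Inter>S \<notin> J"
  using assms unfolding positive_FIP_def positive_def by blast

section \<open>Ultrafilters extending positive families\<close>

text \<open>
  If neither \<open>X\<close> nor its complement can be added, finitely many members of the family meet \<open>X\<close> in
  a set of \<open>J\<close> and finitely many meet \<open>- X\<close> in a set of \<open>J\<close>; all of them together then
  intersect in a set of \<open>J\<close>.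
\<close>

lemma positive_FIP_insert_or_Compl:
  assumes J: "ideal_on_omega J" and A: "positive_FIP J \<A>"
  shows "positive_FIP J (insert X \<A>) \<or> positive_FIP J (insert (- X) \<A>)"
proof (rule ccontr)
  have split: "\<exists>S\<subseteq>\<A>. finite S \<and> \<Inter>S \<inter> Y \<in> J" if "\<not> positive_FIP J (insert Y \<A>)" for Y
  proof -
    have "\<exists>S. S \<subseteq> insert Y \<A> \<and> finite S \<and> \<Inter>S \<in> J"
      using that by (simp add: positive_FIP_def positive_def)
    then obtain S where S: "S \<subseteq> insert Y \<A>" "finite S" "\<Inter>S \<in> J"
      by (elim exE conjE)
    have "\<Inter>(S - {Y}) \<inter> Y \<subseteq> \<Inter>S"
      by auto
    then have "\<Inter>(S - {Y}) \<inter> Y \<in> J"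
      by (rule ideal_subset[OF J S(3)])
    with S show ?thesis
      by (intro exI[of _ "S - {Y}"]) auto
  qed
  assume "\<not> ?thesis"
  then have "\<not> positive_FIP J (insert X \<A>)" "\<not> positive_FIP J (insert (- X) \<A>)"
    by simp_all
  from this[THEN split] obtain S T where S: "S \<subseteq> \<A>" "finite S" "\<Inter>S \<inter> X \<in> J"
    and T: "T \<subseteq> \<A>" "finite T" "\<Inter>T \<inter> - X \<in> J"
    by (elim exE conjE)
  have "(\<Inter>S \<inter> X) \<union> (\<Inter>T \<inter> - X) \<in> J"
    using J S(3) T(3) by (rule ideal_Un)
  moreover have "\<Inter>(S \<union> T) \<subseteq> (\<Inter>S \<inter> X) \<union> (\<Inter>T \<inter> - X)"
    by auto
  ultimately have "\<Inter>(S \<union> T) \<in> J"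
    by (rule ideal_subset[OF J])
  with positive_FIP_InterD[OF A, of "S \<union> T"] S T show False
    by auto
qed

lemma positive_FIP_Union_chain:
  assumes chain: "subset.chain UNIV C" and "C \<noteq> {}"
    and C: "\<And>\<A>. \<A> \<in> C \<Longrightarrow> positive_FIP J \<A>"
  shows "positive_FIP J (\<Union>C)"
proof -
  have "\<Inter>S \<in> positive J" if S: "S \<subseteq> \<Union>C" "finite S" for S
  proof -
    obtain \<A> where "\<A> \<in> C" "S \<subseteq> \<A>"
      using finite_subset_Union_chain[OF S(2,1) \<open>C \<noteq> {}\<close> chain] by blast
    with C S(2) show ?thesis
      unfolding positive_FIP_def by blast
  qed
  moreover have "\<Union>C \<noteq> {}"
    using \<open>C \<noteq> {}\<close> C unfolding positive_FIP_def by blast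
  ultimately show ?thesis
    unfolding positive_FIP_def by blast
qed

text \<open>
  A positive family that contains \<open>X\<close> or \<open>- X\<close> for each \<open>X\<close> is an ultrafilter: a set required to
  belong to it cannot have its complement there, because the complement would intersect one or two
  members in the empty set.
\<close>

lemma positive_FIP_complete_ultrafilter:
  assumes J: "ideal_on_omega J" and U: "positive_FIP J U"
    and complete: "\<And>X. X \<in> U \<or> - X \<in> U"
  shows "ultrafilter_on_omega U" and "J \<subseteq> dual_ideal U"
proof -
  have pos: "X \<notin> J" if "X \<in> U" for X
    using positive_FIP_InterD[OF U, of "{X}"] that by simp
  have fin: "X \<in> J" if "finite X" for X
    using J that unfolding ideal_on_omega_def by simp
  have disjoint: False if "X \<in> U" "Y \<in> U" "Z \<in> U" "X \<inter> Y \<inter> Z = {}" for X Y Z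
    using positive_FIP_InterD[OF U, of "{X, Y, Z}"] that fin[of "{}"] by (simp add: Int_assoc)
  have "{} \<notin> U"
    using pos fin by blast
  moreover have "B \<in> U" if "A \<in> U" "A \<subseteq> B" for A B
    using complete[of B] disjoint[of A A "- B"] that by blast
  moreover have "A \<inter> B \<in> U" if "A \<in> U" "B \<in> U" for A B
    using complete[of "A \<inter> B"] disjoint[of A B "- (A \<inter> B)"] that by blast
  moreover have "A \<in> U" if "finite (- A)" for A
    using complete[of A] pos fin that by blast
  ultimately show "ultrafilter_on_omega U"
    using complete unfolding ultrafilter_on_omega_def by blast
  have "X \<in> dual_ideal U" if "X \<in> J" for X
  proof -
    have "- X \<in> U"
      using complete pos that by blast
    then show ?thesis
      unfolding dual_ideal_def using double_complement[of X] by blast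
  qed
  then show "J \<subseteq> dual_ideal U" ..
qed

lemma positive_FIP_extends_to_ultrafilter:
  assumes J: "ideal_on_omega J" and A: "positive_FIP J \<A>"
  obtains U where "ultrafilter_on_omega U" "\<A> \<subseteq> U" "J \<subseteq> dual_ideal U"
proof -
  let ?P = "{\<B>. \<A> \<subseteq> \<B> \<and> positive_FIP J \<B>}"
  have "?P \<noteq> {}"
    using A by blast
  moreover have "\<Union>C \<in> ?P" if "C \<noteq> {}" "subset.chain ?P C" for C
  proof -
    have "subset.chain UNIV C" "C \<subseteq> ?P"
      using that(2) by (auto simp: subset.chain_def)
    with \<open>C \<noteq> {}\<close> positive_FIP_Union_chain[of C J] show ?thesis
      by blast
  qed
  ultimately have "\<exists>U\<in>?P. \<forall>\<B>\<in>?P. U \<subseteq> \<B> \<longrightarrow> \<B> = U"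
    by (rule subset_Zorn_nonempty)
  then obtain U where U: "U \<in> ?P" and "\<forall>\<B>\<in>?P. U \<subseteq> \<B> \<longrightarrow> \<B> = U"
    by (rule bexE)
  then have max: "\<B> = U" if "\<B> \<in> ?P" "U \<subseteq> \<B>" for \<B>
    using that by simp
  have "Y \<in> U" if "positive_FIP J (insert Y U)" for Y
  proof -
    have "insert Y U = U"
      using U that by (intro max) auto
    then show ?thesis by blast
  qed
  then have "X \<in> U \<or> - X \<in> U" for X
    using positive_FIP_insert_or_Compl[OF J] U by blast
  with positive_FIP_complete_ultrafilter[OF J, of U] U that show thesis
    by blast
qed

section \<open>Enlarging positive families by preimages\<close>

lemma positive_FIP_collapse_finite:
  assumes "positive_FIP J \<A>" "finite \<A>"
  shows "positive_FIP J {\<Inter>\<A>}"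
  unfolding positive_FIP_def
proof (intro conjI allI impI)
  fix S assume "S \<subseteq> {\<Inter>\<A>} \<and> finite S"
  then have "\<Inter>S = \<Inter>{} \<or> \<Inter>S = \<Inter>\<A>"
    by (auto simp: subset_singleton_iff)
  moreover have "\<Inter>T \<in> positive J" if "T \<subseteq> \<A>" for T
    using assms that finite_subset[of T] by (simp add: positive_FIP_def)
  ultimately show "\<Inter>S \<in> positive J"
    using empty_subsetI subset_refl by metis
qed simp

lemma positive_FIP_expand_finite:
  assumes J: "ideal_on_omega J" and "\<A> \<noteq> {}" and pos: "positive_FIP J {\<Inter>\<A>, X}"
  shows "positive_FIP J (\<A> \<union> {X})"
proof -
  have "\<Inter>\<A> \<inter> X \<notin> J"
    using positive_FIP_InterD[OF pos, of "{\<Inter>\<A>, X}"] by simp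
  moreover have "\<Inter>\<A> \<inter> X \<subseteq> \<Inter>S" if "S \<subseteq> \<A> \<union> {X}" for S
    using that by auto
  ultimately have "\<Inter>S \<notin> J" if "S \<subseteq> \<A> \<union> {X}" for S
    using ideal_subset[OF J] that by metis
  with \<open>\<A> \<noteq> {}\<close> show ?thesis
    unfolding positive_FIP_def positive_def by simp
qed

lemma positive_FIP_extend_below_fip:
  assumes "positive_FIP J \<A>" "|\<A>| <o fip I J F" "f \<in> F"
  obtains B where "B \<in> I" "positive_FIP J (\<A> \<union> {f -` B})"
proof -
  have "\<not> fip_family I J F \<A>"
    using fip_le_family assms(2) not_ordLess_ordLeq by blast
  with assms(1,3) that show thesis
    unfolding fip_family_def by blast
qed

text \<open>
  A finite family has the same enlargements as the single set \<open>\<Inter>\<A>\<close>; hence \<open>fip\<close> is never a finite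
  cardinal larger than one.
\<close>

lemma positive_FIP_extend:
  assumes J: "ideal_on_omega J" and A: "positive_FIP J \<A>"
    and small: "finite \<A> \<or> |\<A>| <o fip I J F"
    and one: "|{f}| <o fip I J F" and f: "f \<in> F"
  shows "\<exists>B\<in>I. positive_FIP J (\<A> \<union> {f -` B})"
proof (cases "finite \<A>")
  case True
  have "|{\<Inter>\<A>}| \<le>o |{f}|"
    by (intro card_of_singl_ordLeq) simp
  then have "|{\<Inter>\<A>}| <o fip I J F"
    using one by (rule ordLeq_ordLess_trans)
  from positive_FIP_collapse_finite[OF A True] this f
  obtain B where B: "B \<in> I" "positive_FIP J ({\<Inter>\<A>} \<union> {f -` B})"
    by (rule positive_FIP_extend_below_fip)
  moreover have "\<A> \<noteq> {}"
    using A by (simp add: positive_FIP_def)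
  ultimately have "positive_FIP J (\<A> \<union> {f -` B})"
    by (intro positive_FIP_expand_finite[OF J]) (simp_all add: insert_commute)
  with B(1) show ?thesis ..
next
  case False
  with small have "|\<A>| <o fip I J F"
    by simp
  from positive_FIP_extend_below_fip[OF A this f] show ?thesis
    by blast
qed

section \<open>The recursion along a well-order of the functions\<close>

text \<open>\<open>UNIV\<close> is included because \<open>positive_FIP\<close> fails for the empty family of stage zero.\<close>

definition preimage_family :: "((nat \<Rightarrow> nat) \<Rightarrow> nat set) \<Rightarrow> (nat \<Rightarrow> nat) set \<Rightarrow> nat set set" where
  "preimage_family h M = insert UNIV ((\<lambda>g. g -` h g) ` M)"

lemma finite_subset_under:
  assumes r: "Well_order r" and "finite T" "T \<noteq> {}" "T \<subseteq> Field r"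
  shows "\<exists>g\<in>T. T \<subseteq> insert g (underS r g)"
  using assms(2-4)
proof (induction T rule: finite_ne_induct)
  case (singleton x)
  then show ?case by simp
next
  case (insert x T)
  then obtain g where g: "g \<in> T" "T \<subseteq> Set.insert g (underS r g)"
    by auto
  have trans: "trans r" and total: "Total r"
    using r by (auto simp: order_on_defs)
  have "x \<noteq> g"
    using insert.hyps g by blast
  with total insert.prems g consider "(x, g) \<in> r" | "(g, x) \<in> r"
    unfolding total_on_def by blast
  then show ?case
  proof cases
    case 1
    with \<open>x \<noteq> g\<close> g show ?thesis
      unfolding underS_def by blast
  next
    case 2
    have "y \<in> underS r x" if "y \<in> T" for y
    proof -
      have "(y, x) \<in> r"
        using g that 2 trans unfolding underS_def by (blast dest: transD)
      moreover have "y \<noteq> x"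
        using that insert.hyps by blast
      ultimately show ?thesis
        unfolding underS_def by blast
    qed
    then show ?thesis by blast
  qed
qed

text \<open>
  A finite subfamily already lies in the family of the stage that follows the largest function
  involved.
\<close>

lemma positive_FIP_of_initial_segments:
  assumes J: "ideal_on_omega J" and r: "Well_order r" and M: "M \<subseteq> Field r"
    and stages: "\<And>g. g \<in> M \<Longrightarrow> positive_FIP J (preimage_family h (insert g (underS r g)))"
  shows "positive_FIP J (preimage_family h M)"
  unfolding positive_FIP_def
proof (intro conjI allI impI)
  show "preimage_family h M \<noteq> {}"
    by (simp add: preimage_family_def)
  fix S assume S: "S \<subseteq> preimage_family h M \<and> finite S"
  then have S': "finite (S - {UNIV})" "S - {UNIV} \<subseteq> (\<lambda>g. g -` h g) ` M"
    by (auto simp: preimage_family_def)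
  then obtain T where T: "T \<subseteq> M" "finite T" "S - {UNIV} = (\<lambda>g. g -` h g) ` T"
    using finite_subset_image[OF S'] by blast
  show "\<Inter>S \<in> positive J"
  proof (cases "T = {}")
    case True
    with T have "S \<subseteq> {UNIV}"
      by auto
    then have "\<Inter>S = UNIV"
      by auto
    moreover have "UNIV \<in> positive J"
      using J by (simp add: positive_def ideal_on_omega_def)
    ultimately show ?thesis
      by (rule ssubst)
  next
    case False
    have "T \<subseteq> Field r"
      using T(1) M by (rule subset_trans)
    from finite_subset_under[OF r T(2) False this]
    obtain g where g: "g \<in> T" "T \<subseteq> insert g (underS r g)"
      by (rule bexE)
    have "S \<subseteq> insert UNIV (S - {UNIV})"
      by auto
    also have "\<dots> = preimage_family h T"
      by (simp only: T(3) preimage_family_def)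
    also have "\<dots> \<subseteq> preimage_family h (insert g (underS r g))"
      unfolding preimage_family_def by (intro insert_mono image_mono g(2))
    finally have "S \<subseteq> preimage_family h (insert g (underS r g))" .
    with stages[OF subsetD[OF T(1) g(1)]] S show ?thesis
      by (simp add: positive_FIP_def)
  qed
qed

lemma preimage_family_small:
  assumes "|M| <o \<kappa>"
  shows "finite (preimage_family h M) \<or> |preimage_family h M| <o \<kappa>"
proof (cases "finite M")
  case True
  then show ?thesis by (simp add: preimage_family_def)
next
  case False
  then have "|{UNIV :: nat set}| \<le>o |M|"
    by (intro card_of_singl_ordLeq) auto
  then have "|preimage_family h M| \<le>o |M|"
    unfolding preimage_family_def by (subst insert_is_Un)
      (intro card_of_Un_ordLeq_infinite_Field card_of_image card_of_Card_order,
        simp_all add: Field_card_of False)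
  then show ?thesis
    using assms ordLeq_ordLess_trans by blast
qed

lemma exists_positive_preimage_family:
  fixes F :: "(nat \<Rightarrow> nat) set"
  assumes J: "ideal_on_omega J" and le: "|F| \<le>o fip I J F"
    and one: "\<And>f. f \<in> F \<Longrightarrow> |{f}| <o fip I J F"
  obtains h where "\<And>f. f \<in> F \<Longrightarrow> h f \<in> I" "positive_FIP J (preimage_family h F)"
proof -
  let ?r = "|F|"
  let ?P = "\<lambda>h f B. f \<in> F \<longrightarrow>
    B \<in> I \<and> positive_FIP J (preimage_family h (underS ?r f) \<union> {f -` B})"
  have wo: "Well_order ?r"
    by (rule card_of_Well_order)
  have stage: "preimage_family h (insert f (underS ?r f)) =
      preimage_family h (underS ?r f) \<union> {f -` h f}" for h f
    by (auto simp: preimage_family_def)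
  have "\<exists>h. \<forall>f. ?P h f (h f)"
  proof (rule dependent_wf_choice)
    show "wf (?r - Id)"
      using wo by (simp add: well_order_on_def)
    show "?P h f B = ?P h' f B" if "\<And>g. (g, f) \<in> ?r - Id \<Longrightarrow> h g = h' g" for h h' f B
    proof -
      have "h g = h' g" if "g \<in> underS ?r f" for g
        using that \<open>\<And>g. (g, f) \<in> ?r - Id \<Longrightarrow> h g = h' g\<close> by (auto simp: underS_def)
      then have "preimage_family h (underS ?r f) = preimage_family h' (underS ?r f)"
        by (simp add: preimage_family_def)
      then show ?thesis by simp
    qed
    show "\<exists>B. ?P h f B" if prev: "\<And>g. (g, f) \<in> ?r - Id \<Longrightarrow> ?P h g (h g)" for f h
    proof (cases "f \<in> F")
      case True
      let ?A = "preimage_family h (underS ?r f)"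
      have sub: "underS ?r f \<subseteq> F"
        using underS_Field[of _ ?r] by (auto simp: Field_card_of)
      have "positive_FIP J ?A"
      proof (rule positive_FIP_of_initial_segments[OF J wo])
        show "underS ?r f \<subseteq> Field ?r"
          using sub by (simp add: Field_card_of)
        show "positive_FIP J (preimage_family h (insert g (underS ?r g)))"
          if "g \<in> underS ?r f" for g
          unfolding stage using prev[of g] that sub by (auto simp: underS_def)
      qed
      moreover have "|underS ?r f| <o ?r"
        using True by (intro card_of_underS card_of_Card_order) (simp add: Field_card_of)
      then have "|underS ?r f| <o fip I J F"
        using le by (rule ordLess_ordLeq_trans)
      then have "finite ?A \<or> |?A| <o fip I J F"
        by (rule preimage_family_small)
      ultimately show ?thesis
        using positive_FIP_extend[OF J _ _ one[OF True] True] by blast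
    qed simp
  qed
  then obtain h where h: "\<And>f. ?P h f (h f)"
    by blast
  have "positive_FIP J (preimage_family h F)"
  proof (rule positive_FIP_of_initial_segments[OF J wo])
    show "F \<subseteq> Field ?r"
      by (simp add: Field_card_of)
    show "positive_FIP J (preimage_family h (insert g (underS ?r g)))" if "g \<in> F" for g
      unfolding stage using h[of g] that by blast
  qed
  with h that show thesis
    by blast
qed

section \<open>The ultrafilter\<close>

lemma singleton_less_fip:
  fixes F :: "(nat \<Rightarrow> nat) set"
  assumes le: "|F| \<le>o fip I J F" and single: "is_singleton F \<longrightarrow> |F| <o fip I J F"
    and f: "f \<in> F"
  shows "|{f}| <o fip I J F"
proof (cases "is_singleton F")
  case True
  with f have "F = {f}"
    by (auto simp: is_singleton_def)
  with True single show ?thesis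
    by simp
next
  case False
  have "\<not> |F| \<le>o |{f}|"
  proof
    assume "|F| \<le>o |{f}|"
    then obtain g where "inj_on g F" "g ` F \<subseteq> {f}"
      by (auto simp: card_of_ordLeq[symmetric])
    then have "F \<subseteq> {f}"
      using f by (auto simp: inj_on_def image_subset_iff)
    with f have "F = {f}"
      by (intro equalityI) simp_all
    with False show False
      by simp
  qed
  then have "|{f}| <o |F|"
    using not_ordLeq_iff_ordLess[OF card_of_Well_order card_of_Well_order] by (rule iffD1[rotated])
  then show ?thesis
    using le by (rule ordLess_ordLeq_trans)
qed

lemma not_below_via_dual:
  assumes U: "ultrafilter_on_omega U"
    and h: "\<And>f. f \<in> F \<Longrightarrow> h f \<in> I" "\<And>f. f \<in> F \<Longrightarrow> f -` h f \<in> U"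
  shows "\<not> below_via F I (dual_ideal U)"
proof
  assume "below_via F I (dual_ideal U)"
  then obtain f where f: "f \<in> F" "f -` h f \<in> dual_ideal U"
    using h(1) unfolding below_via_def by blast
  then obtain A where "A \<in> U" "f -` h f = - A"
    unfolding dual_ideal_def by blast
  with h(2)[OF f(1)] U have "A \<inter> - A \<in> U"
    unfolding ultrafilter_on_omega_def by metis
  with U show False
    by (simp add: ultrafilter_on_omega_def)
qed

lemma not_I_point_if_subset_dual:
  assumes "J \<subseteq> dual_ideal U"
  shows "\<not> I_point J U"
proof -
  have "below_via {f. inj f} J (dual_ideal U)"
    unfolding below_via_def
  proof (intro bexI ballI)
    show "id -` B \<in> dual_ideal U" if "B \<in> J" for B
      using assms that by auto
  qed simp
  then show ?thesis
    by (simp add: I_point_def)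
qed

theorem theorem3p2:
  fixes I J :: "nat set set" and F :: "(nat \<Rightarrow> nat) set"
  assumes "ideal_on_omega I" and "ideal_on_omega J"
    and "|F| \<le>o fip I J F"
    and "is_singleton F \<longrightarrow> |F| <o fip I J F"
  shows "(\<exists>U. ultrafilter_on_omega U \<and> \<not> below_via F I (dual_ideal U) \<and> J \<subseteq> dual_ideal U) \<and>
    (F = UNIV \<longrightarrow> (\<exists>U. I_ultrafilter I U \<and> \<not> I_point J U)) \<and>
    (F = {f. finite_to_one f} \<longrightarrow> (\<exists>U. weak_I_ultrafilter I U \<and> \<not> I_point J U)) \<and>
    (F = {f. inj f} \<longrightarrow> (\<exists>U. I_point I U \<and> \<not> I_point J U))"
proof -
  obtain h where h: "\<And>f. f \<in> F \<Longrightarrow> h f \<in> I" and pos: "positive_FIP J (preimage_family h F)"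
    using exists_positive_preimage_family[OF assms(2,3) singleton_less_fip[OF assms(3,4)]]
    by blast
  obtain U where U: "ultrafilter_on_omega U" "preimage_family h F \<subseteq> U" "J \<subseteq> dual_ideal U"
    using positive_FIP_extends_to_ultrafilter[OF assms(2) pos] .
  have not_below: "\<not> below_via F I (dual_ideal U)"
    using U(2) by (intro not_below_via_dual[where h = h, OF U(1) h]) (auto simp: preimage_family_def)
  have not_point: "\<not> I_point J U"
    by (rule not_I_point_if_subset_dual[OF U(3)])
  show ?thesis
  proof (intro conjI impI)
    show "\<exists>U. ultrafilter_on_omega U \<and> \<not> below_via F I (dual_ideal U) \<and> J \<subseteq> dual_ideal U"
      using U not_below by blast
    show "\<exists>U. I_ultrafilter I U \<and> \<not> I_point J U" if "F = UNIV"
      using U(1) not_below not_point that unfolding I_ultrafilter_def by blast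
    show "\<exists>U. weak_I_ultrafilter I U \<and> \<not> I_point J U" if "F = {f. finite_to_one f}"
      using U(1) not_below not_point that unfolding weak_I_ultrafilter_def by blast
    show "\<exists>U. I_point I U \<and> \<not> I_point J U" if "F = {f. inj f}"
      using U(1) not_below not_point that unfolding I_point_def[of I] by blast
  qed
qed

end
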